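(* Let $M\subseteq\mathbb{Z}$ with $1\in M$, let $d$ be a pseudometric on $M$, and let $\preceq_d$ be the corresponding induced preorder on $M$. Then $$M/\!\sim_d\ \sqsubseteq\ M/\!\sim_{\preceq_d},$$ i.e. the partition $M/\!\sim_d$ is a refinement of the partition $M/\!\sim_{\preceq_d}$.
   Context: A pseudometric on $M$ is a function $d:M\times M\to\mathbb{R}$ with $d(x,x)=0$, $d(x,y)=d(y,x)$ and $d(x,z)\le d(x,y)+d(y,z)$ for all $x,y,z\in M$. The induced preorder is $x\preceq_d y\iff d(1,x)\le d(1,y)$. The equivalence relations are $x\sim_d y\iff d(x,y)=0$ and $x\sim_{\preceq_d}y\iff(x\preceq_d y\text{ and }y\preceq_d x)$. For equivalence relations $\sim_1,\sim_2$ on $M$, $M/\!\sim_1\ \sqsubseteq\ M/\!\sim_2$ means $[x]_{\sim_1}\subseteq[x]_{\sim_2}$ for all $x\in M$. *)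

theory Defs
  imports Complex_Main "HOL-Library.Disjoint_Sets"
begin

text \<open>Distances are total functions; only their values on \<open>M\<close> matter, and all relations
  below are relations on \<open>M\<close> (subsets of \<open>M \<times> M\<close>).\<close>

definition pseudometric_on :: "'a set \<Rightarrow> ('a \<Rightarrow> 'a \<Rightarrow> real) \<Rightarrow> bool" where
  "pseudometric_on M d \<longleftrightarrow>
     (\<forall>x\<in>M. d x x = 0) \<and>
     (\<forall>x\<in>M. \<forall>y\<in>M. d x y = d y x) \<and>
     (\<forall>x\<in>M. \<forall>y\<in>M. \<forall>z\<in>M. d x z \<le> d x y + d y z)"

definition induced_preorder :: "'a::one set \<Rightarrow> ('a \<Rightarrow> 'a \<Rightarrow> real) \<Rightarrow> 'a rel" where
  "induced_preorder M d = {(x, y). x \<in> M \<and> y \<in> M \<and> d 1 x \<le> d 1 y}"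

definition metric_equiv :: "'a set \<Rightarrow> ('a \<Rightarrow> 'a \<Rightarrow> real) \<Rightarrow> 'a rel" where
  "metric_equiv M d = {(x, y). x \<in> M \<and> y \<in> M \<and> d x y = 0}"

definition preorder_equiv :: "'a rel \<Rightarrow> 'a rel" where
  "preorder_equiv r = {(x, y). (x, y) \<in> r \<and> (y, x) \<in> r}"

text \<open>\<open>quotient_finer M r s\<close> is the relation \<open>M/r \<sqsubseteq> M/s\<close>; the class of \<open>x\<close> under \<open>r\<close> is
  \<open>r `` {x}\<close>.\<close>

definition quotient_finer :: "'a set \<Rightarrow> 'a rel \<Rightarrow> 'a rel \<Rightarrow> bool" where
  "quotient_finer M r s \<longleftrightarrow> (\<forall>x\<in>M. r `` {x} \<subseteq> s `` {x})"

lemma quotient_finer_iff_refines: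
  assumes r: "equiv M r" and s: "equiv M s"
  shows "quotient_finer M r s \<longleftrightarrow> refines M (M // r) (M // s)"
proof
  assume "quotient_finer M r s"
  then show "refines M (M // r) (M // s)"
    using partition_on_quotient[OF r] partition_on_quotient[OF s]
    by (fastforce simp: refines_def quotient_finer_def quotient_def)
next
  assume ref: "refines M (M // r) (M // s)"
  show "quotient_finer M r s"
    unfolding quotient_finer_def
  proof
    fix x assume x: "x \<in> M"
    then obtain Y where Y: "Y \<in> M // s" "r `` {x} \<subseteq> Y"
      using ref unfolding refines_def by (meson quotientI)
    have "x \<in> Y"
      using Y(2) equiv_class_self[OF r x] by blast
    then have "Y = s `` {x}"
      using Y(1) s x by (metis Image_singleton_iff equiv_class_eq_iff quotientE)
    then show "r `` {x} \<subseteq> s `` {x}"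
      using Y(2) by simp
  qed
qed

lemma preorder_on_induced_preorder: "preorder_on M (induced_preorder M d)"
  by (auto simp: preorder_on_def induced_preorder_def refl_on_def intro!: transI)

lemma equiv_preorder_equiv:
  assumes "preorder_on M r"
  shows "equiv M (preorder_equiv r)"
  using assms unfolding preorder_on_def preorder_equiv_def
  by (intro equivI) (auto simp: refl_on_def intro!: symI transI dest: transD)

lemma pseudometric_on_nonneg:
  assumes "pseudometric_on M d" "x \<in> M" "y \<in> M"
  shows "0 \<le> d x y"
proof -
  have "d x x \<le> d x y + d y x" "d x x = 0" "d x y = d y x"
    using assms unfolding pseudometric_on_def by blast+
  then show ?thesis by simp
qed

lemma equiv_metric_equiv:
  assumes "pseudometric_on M d"
  shows "equiv M (metric_equiv M d)"
proof (rule equivI)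
  show "trans (metric_equiv M d)"
  proof (rule transI)
    fix x y z assume "(x, y) \<in> metric_equiv M d" "(y, z) \<in> metric_equiv M d"
    then have *: "x \<in> M" "y \<in> M" "z \<in> M" "d x y = 0" "d y z = 0"
      by (auto simp: metric_equiv_def)
    then have "d x z \<le> d x y + d y z"
      using assms unfolding pseudometric_on_def by blast
    then have "d x z = 0"
      using * pseudometric_on_nonneg[OF assms, of x z] by simp
    then show "(x, z) \<in> metric_equiv M d"
      using * by (simp add: metric_equiv_def)
  qed
qed (use assms in \<open>auto simp: metric_equiv_def pseudometric_on_def refl_on_def intro!: symI\<close>)

end

theory Submission
  imports Defs
begin

text \<open>Two points at distance 0 are equally far from any third point of \<open>M\<close>, by
  the triangle inequality used in both directions. With \<open>1\<close> as third point,
  \<open>d 1 x = d 1 y\<close>, so each of \<open>x\<close>, \<open>y\<close> precedes the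
  other.\<close>

theorem proposition2p4:
  fixes M :: "int set" and d :: "int \<Rightarrow> int \<Rightarrow> real"
  assumes "1 \<in> M" and "pseudometric_on M d"
  shows "quotient_finer M (metric_equiv M d) (preorder_equiv (induced_preorder M d))"
proof -
  have "d 1 x = d 1 y" if "x \<in> M" "y \<in> M" "d x y = 0" for x y
  proof -
    \<comment> \<open>Symmetry makes \<open>d y x\<close> vanish too, so the two triangle
      inequalities, both through the base point \<open>1\<close>, become opposite bounds.\<close>
    have "d 1 y \<le> d 1 x + d x y" "d 1 x \<le> d 1 y + d y x" "d x y = d y x"
      using assms that unfolding pseudometric_on_def by blast+
    then show ?thesis
      using that by simp
  qed
  then show ?thesis
    by (fastforce simp: quotient_finer_def metric_equiv_def preorder_equiv_def induced_preorder_def)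
qed

end
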